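(* Let $B_r\subset\mathbb{R}^n$ denote the open ball of radius $r$ centered at the origin, let $S_1=\partial B_1$ be the unit sphere, and let $\alpha\in(0,1]$. Let $g:S_1\to\mathbb{R}$ be of class $C^{1,\alpha}$ on $S_1$, and let $u$ be the convex envelope of the boundary data $g$ on $B_1$ (equivalently, the solution of the Dirichlet problem $\lambda_1[u]=0$ in $B_1$, $u=g$ on $\partial B_1$). Then $u\in C^{1,\alpha}(B_{1/2})$. Moreover, $$\|u\|_{C^{1,\alpha}(B_{1/2})}\le C\,\|g\|_{C^{1,\alpha}(\partial B_1)},$$ where the constant $C$ depends only on the dimension $n$ and on $\alpha$.
   Context: The convex envelope of the boundary data $g$ on $B_1$ is the function $$u(x)=\sup\{v(x)\mid v:\mathbb{R}^n\to\mathbb{R}\text{ convex},\ v(y)\le g(y)\ \text{for all } y\in\partial B_1\},\qquad x\in B_1 .$$ Equivalently, $u(x)=\max\{L(x)\mid L(z)=A\cdot z+b \text{ affine},\ L\le g\text{ on }\partial B_1\}$ for $x\in B_1$. Here $\lambda_1[u](x)$ denotes the smallest eigenvalue of the Hessian $D^2u(x)$, and the equation $\lambda_1[u]=0$ is understood in the viscosity sense, characterized by the formula above. The function $u$ need not attain the boundary values $g$ continuously. The norm $\|\cdot\|_{C^{1,\alpha}}$ is the usual Hölder norm: the sup norms of the function and its first derivatives (tangential derivatives on the sphere) plus the $\alpha$-Hölder seminorm of the first derivatives. *)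

theory Defs
  imports "HOL-Analysis.Analysis"
begin

text \<open>
  Only the values of \<open>g\<close> on the unit sphere matter. The function is meaningful on the open unit
  ball: for \<open>g\<close> bounded on the sphere the family is nonempty and bounded above at each such \<open>x\<close>,
  so the real supremum is the true one.
\<close>

definition convex_envelope :: "('a::euclidean_space \<Rightarrow> real) \<Rightarrow> 'a \<Rightarrow> real" where
  "convex_envelope g x =
     (SUP v \<in> {v. convex_on UNIV v \<and> (\<forall>y\<in>sphere 0 1. v y \<le> g y)}. v x)"

definition gradient :: "('a::euclidean_space \<Rightarrow> real) \<Rightarrow> 'a \<Rightarrow> 'a" where
  "gradient f x = (THE p. GDERIV f x :> p)"

text \<open>
  The differential of a function on the unit sphere at \<open>x\<close> is represented by a vector of the ambient
  space lying in the tangent space at \<open>x\<close>, the orthogonal complement of \<open>x\<close>. Differentiability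
  within the sphere is differentiability along the manifold, and it determines the vector only up
  to multiples of \<open>x\<close>, whence the orthogonality condition.
\<close>

definition has_tangential_gradient ::
    "('a::euclidean_space \<Rightarrow> real) \<Rightarrow> 'a \<Rightarrow> 'a \<Rightarrow> bool" where
  "has_tangential_gradient g p x \<longleftrightarrow>
     p \<bullet> x = 0 \<and> (g has_derivative (\<lambda>h. h \<bullet> p)) (at x within sphere 0 1)"

definition tangential_gradient :: "('a::euclidean_space \<Rightarrow> real) \<Rightarrow> 'a \<Rightarrow> 'a" where
  "tangential_gradient g x = (THE p. has_tangential_gradient g p x)"

definition holder_quotients ::
    "real \<Rightarrow> 'a::euclidean_space set \<Rightarrow> ('a \<Rightarrow> 'a) \<Rightarrow> real set" where
  "holder_quotients \<alpha> X G =
     {norm (G x - G y) / dist x y powr \<alpha> | x y. x \<in> X \<and> y \<in> X \<and> x \<noteq> y}"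

text \<open>
  The next two definitions take the gradient field \<open>G\<close> of \<open>f\<close> on \<open>X\<close> as a parameter, to serve both
  the ball and the sphere. The first one says that the three suprema in the second are finite.
\<close>

definition C1_holder_bounded ::
    "real \<Rightarrow> 'a::euclidean_space set \<Rightarrow> ('a \<Rightarrow> real) \<Rightarrow> ('a \<Rightarrow> 'a) \<Rightarrow> bool" where
  "C1_holder_bounded \<alpha> X f G \<longleftrightarrow>
     bdd_above ((\<lambda>x. \<bar>f x\<bar>) ` X) \<and>
     bdd_above ((\<lambda>x. norm (G x)) ` X) \<and>
     bdd_above (holder_quotients \<alpha> X G)"

definition C1_holder_norm ::
    "real \<Rightarrow> 'a::euclidean_space set \<Rightarrow> ('a \<Rightarrow> real) \<Rightarrow> ('a \<Rightarrow> 'a) \<Rightarrow> real" where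
  "C1_holder_norm \<alpha> X f G =
     (SUP x\<in>X. \<bar>f x\<bar>) + (SUP x\<in>X. norm (G x)) + Sup (holder_quotients \<alpha> X G)"

text \<open>
  Continuity of the first derivatives is not listed in the two classes below, as it follows from
  the bound on the Hoelder quotients when \<open>\<alpha> > 0\<close>.
\<close>

definition C1_holder_on ::
    "real \<Rightarrow> 'a::euclidean_space set \<Rightarrow> ('a \<Rightarrow> real) \<Rightarrow> bool" where
  "C1_holder_on \<alpha> U f \<longleftrightarrow>
     (\<forall>x\<in>U. \<exists>p. GDERIV f x :> p) \<and> C1_holder_bounded \<alpha> U f (gradient f)"

definition C1_holder_sphere :: "real \<Rightarrow> ('a::euclidean_space \<Rightarrow> real) \<Rightarrow> bool" where
  "C1_holder_sphere \<alpha> g \<longleftrightarrow>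
     (\<forall>x\<in>sphere 0 1. \<exists>p. has_tangential_gradient g p x) \<and>
     C1_holder_bounded \<alpha> (sphere 0 1) g (tangential_gradient g)"

text \<open>Both gradients are unique where they exist, so the definite descriptions are proper.\<close>

lemma gradient_eq: "GDERIV f x :> p \<Longrightarrow> gradient f x = p"
proof -
  assume p: "GDERIV f x :> p"
  have "q = p" if "GDERIV f x :> q" for q
  proof -
    have "(\<lambda>h. h \<bullet> q) = (\<lambda>h. h \<bullet> p)"
      using has_derivative_unique p that unfolding gderiv_def by blast
    then have "\<forall>h. h \<bullet> q = h \<bullet> p" by (simp add: fun_eq_iff)
    then show ?thesis by (simp only: vector_eq_ldot)
  qed
  with p show ?thesis unfolding gradient_def by blast
qed

lemma has_tangential_gradient_unique:
  assumes x: "x \<in> sphere 0 1"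
    and p: "has_tangential_gradient g p x" and q: "has_tangential_gradient g q x"
  shows "p = q"
proof (rule ccontr)
  assume ne: "p \<noteq> q"
  define e where "e = (p - q) /\<^sub>R norm (p - q)"
  have e1: "e \<bullet> e = 1"
  proof -
    have "norm e = 1" using ne by (simp add: e_def)
    then show ?thesis by (simp only: norm_eq_1)
  qed
  have "p \<bullet> x = 0" "q \<bullet> x = 0"
    using p q by (simp_all only: has_tangential_gradient_def)
  then have ex: "e \<bullet> x = 0"
    by (simp add: e_def inner_diff_left)
  then have ex': "x \<bullet> e = 0"
    by (simp only: inner_commute)
  have xx: "x \<bullet> x = 1" using x by (simp add: norm_eq_1[symmetric])
  define c where "c t = cos t *\<^sub>R x + sin t *\<^sub>R e" for t :: real
  have "c t \<bullet> c t = 1" for t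
  proof -
    have "c t \<bullet> c t = (cos t)\<^sup>2 + (sin t)\<^sup>2"
      by (simp add: c_def inner_add_left inner_add_right ex ex' xx e1 power2_eq_square)
    then show ?thesis by simp
  qed
  then have cS: "range c \<subseteq> sphere 0 1"
    by (auto simp: norm_eq_1)
  have cd: "(c has_derivative (\<lambda>t. t *\<^sub>R e)) (at 0)"
    unfolding c_def by (auto intro!: derivative_eq_intros)
  have c0: "c 0 = x" by (simp add: c_def)
  have D: "((\<lambda>t. g (c t)) has_derivative (\<lambda>t. (t *\<^sub>R e) \<bullet> r)) (at 0)"
    if "has_tangential_gradient g r x" for r
  proof -
    have "(g has_derivative (\<lambda>h. h \<bullet> r)) (at (c 0) within range c)"
      using that cS unfolding has_tangential_gradient_def c0
      by (blast intro: has_derivative_subset)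
    from has_derivative_in_compose[OF cd this] show ?thesis by simp
  qed
  have "(\<lambda>t. (t *\<^sub>R e) \<bullet> p) = (\<lambda>t. (t *\<^sub>R e) \<bullet> q)"
    using has_derivative_unique[OF D[OF p] D[OF q]] .
  from fun_cong[OF this, of 1] have "e \<bullet> (p - q) = 0"
    by (simp add: inner_diff_right)
  with ne show False by (simp add: e_def)
qed

lemma tangential_gradient_eq:
  "x \<in> sphere 0 1 \<Longrightarrow> has_tangential_gradient g p x \<Longrightarrow> tangential_gradient g x = p"
  unfolding tangential_gradient_def
  using has_tangential_gradient_unique by blast

end

theory Submission imports Defs begin

text \<open>
  Write \<open>u\<close> for the convex envelope of \<open>g\<close>. At a point \<open>x\<close> of the open ball, \<open>u\<close> is touched
  from below by an affine function \<open>L\<close> with \<open>L \<le> g\<close> on the sphere, and \<open>x\<close> is a convex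
  combination of points of the contact set \<open>{y. g y = L y}\<close> on the sphere. This is read off the
  lower boundary of the convex hull of the graph of \<open>g\<close> (\<open>convex_envelope_support\<close>).

  For regularity it suffices to bound \<open>u - L\<close> from above by \<open>K * norm (w - x) powr (1 + \<alpha>)\<close>, since
  \<open>u - L\<close> is nonnegative. At a contact point the nonnegative function \<open>g - L\<close> has a
  minimum along the sphere, so its tangential derivative vanishes there, and as that derivative is
  Hoelder continuous, \<open>g - L\<close> grows at most like \<open>K * dist powr (1 + \<alpha>)\<close>
  (\<open>sphere_growth_from_minimum\<close>). To transport this bound to the interior, replace \<open>x\<close> by \<open>w\<close>
  and each contact point \<open>y\<close> by the point \<open>y'\<close> where the ray from \<open>w\<close> in the direction \<open>y - x\<close>
  meets the sphere. If \<open>x\<close> is in the hull of the points \<open>y\<close>, then \<open>w\<close> is in the hull of the points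
  \<open>y'\<close>, because the directions are the same; and \<open>dist y' y\<close> is at most \<open>4 * norm (w - x)\<close> as
  long as \<open>x\<close> stays away from the sphere (\<open>sphere_point_parallel_transport\<close>). Hence \<open>u w - L w\<close> is
  at most the largest value of \<open>g - L\<close> at the points \<open>y'\<close>, which is of the desired order
  (\<open>convex_envelope_upper_growth\<close>).

  So \<open>u\<close> is differentiable with gradient the slope of \<open>L\<close>. Comparing the upper bound at one point with
  the supporting affine function at another makes the gradient Hoelder continuous
  (\<open>subgradient_holder\<close>). The restriction \<open>norm x < 1/2\<close> also bounds the slope of \<open>L\<close> by a
  multiple of the supremum of \<open>\<bar>g\<bar>\<close> (\<open>supporting_slope_bound\<close>), and all constants are numerical.
\<close>

section \<open>Supporting affine functions of the convex envelope\<close>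

lemma convex_hull_meets_halfspace:
  fixes x p :: "'a::euclidean_space"
  assumes "x \<in> convex hull Z"
  shows "\<exists>y\<in>Z. 0 \<le> p \<bullet> (y - x)"
proof (rule ccontr)
  assume "\<not> ?thesis"
  then have "Z \<subseteq> {z. p \<bullet> z < p \<bullet> x}"
    by (auto simp: inner_diff_right not_le)
  then have "convex hull Z \<subseteq> {z. p \<bullet> z < p \<bullet> x}"
    by (rule hull_minimal) (rule convex_halfspace_lt)
  with assms show False by auto
qed

text \<open>
  A face of the convex hull of a graph is the hull of the part of the graph in that face: the points
  strictly above the affine function, together with the points on it that lie over the
  hull of the contact set, form a convex set that contains the graph.
\<close>

lemma convex_hull_contact_set:
  fixes g :: "'a::euclidean_space \<Rightarrow> real"
  assumes le: "\<And>y. y \<in> S \<Longrightarrow> c + q \<bullet> y \<le> g y"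
    and x: "(x, c + q \<bullet> x) \<in> convex hull ((\<lambda>y. (y, g y)) ` S)"
  shows "x \<in> convex hull {y\<in>S. g y = c + q \<bullet> y}"
proof -
  define H where "H = convex hull {y\<in>S. g y = c + q \<bullet> y}"
  define F where "F = {z. c + q \<bullet> fst z < snd z \<or> (snd z = c + q \<bullet> fst z \<and> fst z \<in> H)}"
  have cH: "convex H" unfolding H_def by (rule convex_convex_hull)
  have cF: "convex F"
  proof (rule convexI)
    fix z z' and a b :: real
    assume z: "z \<in> F" "z' \<in> F" and ab: "0 \<le> a" "0 \<le> b" "a + b = 1"
    define e where "e = snd z - (c + q \<bullet> fst z)"
    define e' where "e' = snd z' - (c + q \<bullet> fst z')"
    have ee: "e \<ge> 0" "e' \<ge> 0" using z by (auto simp: F_def e_def e'_def)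
    have "c = a * c + b * c" using ab(3) by (metis distrib_right mult_1)
    then have eq: "snd (a *\<^sub>R z + b *\<^sub>R z') - (c + q \<bullet> fst (a *\<^sub>R z + b *\<^sub>R z')) = a * e + b * e'"
      by (simp add: e_def e'_def inner_add_right algebra_simps)
    show "a *\<^sub>R z + b *\<^sub>R z' \<in> F"
    proof (cases "a * e + b * e' = 0")
      case False
      then have "a * e + b * e' > 0" using ee ab by (smt (verit) mult_nonneg_nonneg)
      with eq show ?thesis unfolding F_def by simp
    next
      case True
      then have 0: "a * e = 0" "b * e' = 0"
        using ee ab by (smt (verit) mult_nonneg_nonneg)+
      have "fst (a *\<^sub>R z + b *\<^sub>R z') \<in> H"
      proof (cases "a = 0 \<or> b = 0")
        case True
        then show ?thesis using 0 ab z by (auto simp: F_def e_def e'_def)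
      next
        case False
        then have "e = 0" "e' = 0" using 0 by auto
        then have "fst z \<in> H" "fst z' \<in> H" using z by (auto simp: F_def e_def e'_def)
        then show ?thesis using cH ab by (simp add: convexD)
      qed
      with eq True show ?thesis unfolding F_def by simp
    qed
  qed
  have "(\<lambda>y. (y, g y)) ` S \<subseteq> F"
  proof
    fix z assume "z \<in> (\<lambda>y. (y, g y)) ` S"
    then obtain y where y: "y \<in> S" "z = (y, g y)" by auto
    show "z \<in> F"
    proof (cases "g y = c + q \<bullet> y")
      case True
      then have "y \<in> H" unfolding H_def using y by (simp add: hull_inc)
      with True y show ?thesis by (simp add: F_def)
    next
      case False
      with le[OF y(1)] y show ?thesis by (simp add: F_def)
    qed
  qed
  then have "convex hull ((\<lambda>y. (y, g y)) ` S) \<subseteq> F"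
    using cF by (rule hull_minimal)
  with x have "(x, c + q \<bullet> x) \<in> F" by blast
  then show ?thesis by (simp add: F_def H_def)
qed

lemma convex_le_on_graph_hull:
  fixes g :: "'a::euclidean_space \<Rightarrow> real"
  assumes v: "convex_on UNIV v" and le: "\<And>y. y \<in> S \<Longrightarrow> v y \<le> g y"
    and x: "(x, t) \<in> convex hull ((\<lambda>y. (y, g y)) ` S)"
  shows "v x \<le> t"
proof -
  have "convex (epigraph UNIV v)" using v by (simp add: convex_epigraph)
  moreover have "(\<lambda>y. (y, g y)) ` S \<subseteq> epigraph UNIV v"
    using le by (auto simp: epigraph_def)
  ultimately have "convex hull ((\<lambda>y. (y, g y)) ` S) \<subseteq> epigraph UNIV v"
    by (simp add: hull_minimal)
  with x show ?thesis by (auto simp: epigraph_def)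
qed

lemma graph_hull_over_cball:
  fixes g :: "'a::euclidean_space \<Rightarrow> real"
  assumes "x \<in> cball 0 1"
  shows "\<exists>t. (x, t) \<in> convex hull ((\<lambda>y. (y, g y)) ` sphere 0 1)"
proof -
  have "cball (0::'a) 1 = convex hull (sphere 0 1)"
    using Krein_Milman_frontier[of "cball (0::'a) 1"] by simp
  with assms have "x \<in> convex hull (sphere 0 1)" by blast
  also have "sphere 0 1 = fst ` ((\<lambda>y. (y, g y)) ` sphere 0 1)"
    by (simp add: image_image)
  also have "convex hull \<dots> = fst ` (convex hull ((\<lambda>y. (y, g y)) ` sphere 0 1))"
    by (rule convex_hull_linear_image[symmetric]) (rule linear_fst)
  finally show ?thesis by force
qed

lemma affine_le_convex_envelope:
  fixes g :: "'a::euclidean_space \<Rightarrow> real"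
  assumes le: "\<And>y. y \<in> sphere 0 1 \<Longrightarrow> c + q \<bullet> y \<le> g y" and x: "x \<in> cball 0 1"
  shows "c + q \<bullet> x \<le> convex_envelope g x"
proof -
  obtain t where t: "(x, t) \<in> convex hull ((\<lambda>y. (y, g y)) ` sphere 0 1)"
    using graph_hull_over_cball[OF x] by blast
  have bdd: "bdd_above ((\<lambda>v. v x) ` {v. convex_on UNIV v \<and> (\<forall>y\<in>sphere 0 1. v y \<le> g y)})"
    using convex_le_on_graph_hull[OF _ _ t] by (intro bdd_aboveI2[where M = t]) blast
  have "convex_on UNIV (\<lambda>y. c + q \<bullet> y)"
    by (intro convex_onI) (auto simp: inner_add_right algebra_simps)
  then show ?thesis
    unfolding convex_envelope_def
    using cSUP_upper[OF _ bdd, of "\<lambda>y. c + q \<bullet> y"] le by auto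
qed

text \<open>
  The vertical line over \<open>x\<close> meets the compact convex hull of the graph of \<open>g\<close> in a lowest point.
  Separating the hull from the open ray below that point gives the affine function; the
  separating hyperplane is not vertical since \<open>x\<close> is an interior point of the projection of the hull.
\<close>

lemma convex_envelope_support:
  fixes g :: "'a::euclidean_space \<Rightarrow> real"
  assumes g: "continuous_on (sphere 0 1) g" and x: "x \<in> ball 0 1"
  obtains q where
    "\<And>y. y \<in> sphere 0 1 \<Longrightarrow> convex_envelope g x + q \<bullet> (y - x) \<le> g y"
    "x \<in> convex hull {y \<in> sphere 0 1. g y = convex_envelope g x + q \<bullet> (y - x)}"
proof -
  define K where "K = convex hull ((\<lambda>y. (y, g y)) ` sphere 0 1)"
  have "compact ((\<lambda>y. (y, g y)) ` sphere (0::'a) 1)"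
    by (intro compact_continuous_image continuous_intros g) simp
  then have K: "compact K" unfolding K_def by (rule compact_convex_hull)
  define T where "T = snd ` (K \<inter> (\<lambda>z. fst z) -` {x})"
  have "closed ((\<lambda>z::'a\<times>real. fst z) -` {x})"
    by (intro closed_vimage closed_singleton continuous_intros)
  then have T: "compact T" unfolding T_def
    by (intro compact_continuous_image compact_Int_closed K continuous_intros)
  obtain t0 where "(x, t0) \<in> K"
    using graph_hull_over_cball[of x g] x unfolding K_def by auto
  then have "T \<noteq> {}" by (force simp: T_def)
  with T obtain m where m: "m \<in> T" "\<And>t. t \<in> T \<Longrightarrow> m \<le> t"
    using compact_attains_inf by metis
  have mK: "(x, m) \<in> K" using m(1) by (auto simp: T_def)
  have mmin: "m \<le> t" if "(x, t) \<in> K" for t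
    using that by (intro m(2)) (force simp: T_def)
  have "convex ({x} \<times> {..<m})" by (intro convex_Times) auto
  moreover have "convex K" unfolding K_def by (rule convex_convex_hull)
  moreover have "({x} \<times> {..<m}) \<inter> K = {}" using mmin by force
  moreover have "{x} \<times> {..<m} \<noteq> {}" by (auto simp: lessThan_empty_iff)
  moreover have "K \<noteq> {}" using mK by auto
  ultimately obtain a b where ab: "a \<noteq> 0" "\<forall>z\<in>{x} \<times> {..<m}. a \<bullet> z \<le> b" "\<forall>z\<in>K. a \<bullet> z \<ge> b"
    using separating_hyperplane_sets by metis
  define p k where "p = fst a" and "k = snd a"
  have low: "p \<bullet> x + k * t \<le> b" if "t < m" for t
    using ab(2) that by (auto simp: p_def k_def inner_prod_def)
  have up: "b \<le> p \<bullet> y + k * t" if "(y, t) \<in> K" for y t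
    using ab(3) that by (auto simp: p_def k_def inner_prod_def)
  have k0: "k \<ge> 0"
  proof -
    have "k * (m - 1) \<le> k * m" using low[of "m - 1"] up[OF mK] by simp
    then show ?thesis by (simp add: algebra_simps)
  qed
  have kpos: "k > 0"
  proof (rule ccontr)
    assume "\<not> k > 0"
    with k0 have k: "k = 0" by simp
    with ab(1) have p: "p \<noteq> 0" by (auto simp: p_def k_def prod_eq_iff)
    define y where "y = - (p /\<^sub>R norm p)"
    have "y \<in> cball 0 1" using p by (simp add: y_def)
    then obtain t where "(y, t) \<in> K" using graph_hull_over_cball unfolding K_def by blast
    from up[OF this] low[of "m - 1"] k have "p \<bullet> x \<le> p \<bullet> y" by simp
    also have "p \<bullet> y = - norm p"
      using p by (simp add: y_def dot_square_norm power2_eq_square)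
    finally have "norm p \<le> - (p \<bullet> x)" by simp
    also have "\<dots> \<le> norm p * norm x"
      using Cauchy_Schwarz_ineq2[of p x] by simp
    also have "\<dots> < norm p" using x p by simp
    finally show False by simp
  qed
  have lim: "p \<bullet> x + k * m \<le> b"
  proof (rule field_le_epsilon)
    fix e :: real assume "e > 0"
    then have "p \<bullet> x + k * (m - e / k) \<le> b" using low[of "m - e / k"] kpos by simp
    then show "p \<bullet> x + k * m \<le> b + e" using kpos by (simp add: algebra_simps)
  qed
  define q where "q = - (p /\<^sub>R k)"
  have qle: "m + q \<bullet> (y - x) \<le> t" if "(y, t) \<in> K" for y t
  proof -
    have "p \<bullet> x + k * m \<le> p \<bullet> y + k * t" using lim up[OF that] by simp
    then have "k * m \<le> p \<bullet> (y - x) + k * t" by (simp add: inner_diff_right)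
    then have "k * m / k \<le> (p \<bullet> (y - x) + k * t) / k" using kpos by (intro divide_right_mono) auto
    then show ?thesis using kpos by (simp add: q_def field_simps)
  qed
  have le: "(m - q \<bullet> x) + q \<bullet> y \<le> g y" if "y \<in> sphere 0 1" for y
  proof -
    have "(y, g y) \<in> K" unfolding K_def using that by (intro hull_inc) auto
    from qle[OF this] show ?thesis by (simp add: inner_diff_right)
  qed
  have "m \<le> convex_envelope g x"
    using affine_le_convex_envelope[of "m - q \<bullet> x" q g x] le x by simp
  moreover have "convex_envelope g x \<le> m"
    unfolding convex_envelope_def
  proof (rule cSUP_least)
    have "convex_on UNIV (\<lambda>y. (m - q \<bullet> x) + q \<bullet> y)"
      by (intro convex_onI) (auto simp: inner_add_right algebra_simps)
    with le show "{v. convex_on UNIV v \<and> (\<forall>y\<in>sphere 0 1. v y \<le> g y)} \<noteq> {}" by blast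
  next
    fix v assume "v \<in> {v. convex_on UNIV v \<and> (\<forall>y\<in>sphere 0 1. v y \<le> g y)}"
    then show "v x \<le> m"
      using convex_le_on_graph_hull[of v "sphere 0 1" g x m] mK by (auto simp: K_def)
  qed
  ultimately have um: "convex_envelope g x = m" by simp
  have "x \<in> convex hull {y \<in> sphere 0 1. g y = (m - q \<bullet> x) + q \<bullet> y}"
    by (rule convex_hull_contact_set[OF le]) (use mK in \<open>auto simp: K_def\<close>)
  then show thesis
    using le by (intro that[of q]) (auto simp: um inner_diff_right algebra_simps)
qed

lemma convex_envelope_bounds:
  fixes g :: "'a::euclidean_space \<Rightarrow> real"
  assumes g: "continuous_on (sphere 0 1) g" and M: "\<And>y. y \<in> sphere 0 1 \<Longrightarrow> \<bar>g y\<bar> \<le> M"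
    and x: "x \<in> ball 0 1"
  shows "\<bar>convex_envelope g x\<bar> \<le> M"
proof -
  obtain q where q: "x \<in> convex hull {y \<in> sphere 0 1. g y = convex_envelope g x + q \<bullet> (y - x)}"
    using convex_envelope_support[OF g x] by blast
  \<comment> \<open>At a contact point on the uphill side of the supporting function, \<open>g\<close> is at least the envelope at \<open>x\<close>.\<close>
  then obtain y where "y \<in> sphere 0 1" "g y = convex_envelope g x + q \<bullet> (y - x)"
    "0 \<le> q \<bullet> (y - x)"
    using convex_hull_meets_halfspace[OF q, of q] by auto
  then have "convex_envelope g x \<le> M" using M[of y] by simp
  moreover have "- M + 0 \<bullet> x \<le> convex_envelope g x"
    using M x by (intro affine_le_convex_envelope) (force simp: abs_le_iff)+
  ultimately show ?thesis by simp
qed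

text \<open>
  An affine function that is at least \<open>- M\<close> at \<open>x\<close> and at most \<open>M\<close> at \<open>q /\<^sub>R norm q\<close> cannot be
  steep, as it rises by at least \<open>norm q / 2\<close> between these points when
  \<open>norm x \<le> 1/2\<close>.
\<close>

lemma supporting_slope_bound:
  fixes g :: "'a::euclidean_space \<Rightarrow> real"
  assumes M: "\<And>y. y \<in> sphere 0 1 \<Longrightarrow> g y \<le> M" and c: "- M \<le> c"
    and x: "x \<in> ball 0 (1/2)"
    and le: "\<And>y. y \<in> sphere 0 1 \<Longrightarrow> c + q \<bullet> (y - x) \<le> g y"
  shows "norm q \<le> 4 * M"
proof (cases "q = 0")
  case True
  obtain y :: 'a where "norm y = 1" using vector_choose_size[of 1] by auto
  then have "c \<le> M" using M[of y] le[of y] True by simp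
  with c True show ?thesis by simp
next
  case False
  define y where "y = q /\<^sub>R norm q"
  have y: "y \<in> sphere 0 1" using False by (simp add: y_def)
  have "q \<bullet> y = norm q" using False by (simp add: y_def dot_square_norm power2_eq_square)
  moreover have "q \<bullet> x \<le> norm q / 2"
  proof -
    have "q \<bullet> x \<le> norm q * norm x" by (rule norm_cauchy_schwarz)
    also have "\<dots> \<le> norm q * (1/2)" using x by (intro mult_left_mono) auto
    finally show ?thesis by simp
  qed
  ultimately have "norm q / 2 \<le> q \<bullet> (y - x)" by (simp add: inner_diff_right)
  with le[OF y] M[OF y] c show ?thesis by simp
qed

section \<open>Growth on the sphere away from a contact point\<close>

lemma angle_le_twice_sin:
  fixes t :: real
  assumes "0 \<le> t" "t \<le> pi" "1/2 \<le> cos t"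
  shows "t \<le> 2 * sin t"
proof (cases "t = 0")
  case False
  with assms have t: "0 < t" by simp
  have "\<exists>z>0. z < t \<and> sin t - sin 0 = (t - 0) * cos z"
    using t by (intro MVT2) (auto intro!: derivative_eq_intros)
  then obtain z where z: "0 < z" "z < t" "sin t = t * cos z" by auto
  have "cos t \<le> cos z" using z assms by (intro cos_monotone_0_pi_le) auto
  then have "t * (1/2) \<le> t * cos z" using t assms by (intro mult_left_mono) auto
  with z show ?thesis by simp
qed simp

text \<open>
  Along a unit-speed great circle \<open>k\<close> from \<open>x\<close> through \<open>y\<close> the difference of \<open>g\<close> and the
  affine function has derivative \<open>k' \<bullet> (G k - q)\<close>, which vanishes at the minimum \<open>x\<close>. Its
  variation is controlled by that of \<open>G\<close> and by the turning of the tangent vector \<open>k'\<close>, which is where the term \<open>N + Q\<close> enters.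
\<close>

lemma sphere_growth_near_minimum:
  fixes g :: "'a::euclidean_space \<Rightarrow> real" and G :: "'a \<Rightarrow> 'a"
  assumes \<alpha>: "0 < \<alpha>" "\<alpha> \<le> 1"
    and G: "\<And>y. y \<in> sphere 0 1 \<Longrightarrow> has_tangential_gradient g (G y) y"
    and H: "\<And>y z. y \<in> sphere 0 1 \<Longrightarrow> z \<in> sphere 0 1 \<Longrightarrow>
              norm (G y - G z) \<le> H * dist y z powr \<alpha>"
    and N: "norm (G x) \<le> N" and Q: "norm q \<le> Q" and H0: "0 \<le> H"
    and le: "\<And>y. y \<in> sphere 0 1 \<Longrightarrow> c + q \<bullet> y \<le> g y" and eq: "g x = c + q \<bullet> x"
    and x: "x \<in> sphere 0 1" and y: "y \<in> sphere 0 1" and d: "dist y x \<le> 1"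
  shows "g y - (c + q \<bullet> y) \<le> 4 * (H + N + Q) * dist y x powr (1 + \<alpha>)"
proof (cases "y = x")
  case True
  then show ?thesis using eq by simp
next
  case False
  define r where "r = dist y x"
  have r: "0 < r" "r \<le> 1" using False d by (auto simp: r_def)
  have xx: "x \<bullet> x = 1" and yy: "y \<bullet> y = 1" using x y by (simp_all add: norm_eq_1[symmetric])
  have "r\<^sup>2 = 2 - 2 * (x \<bullet> y)"
    by (simp add: r_def dist_norm power2_norm_eq_inner inner_diff_left inner_diff_right xx yy
          inner_commute)
  moreover have "0 < r\<^sup>2" "r\<^sup>2 \<le> 1" using r by (simp_all add: power_le_one)
  ultimately have xy: "1/2 \<le> x \<bullet> y" "x \<bullet> y < 1" by simp_all
  define t where "t = arccos (x \<bullet> y)"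
  have ct: "cos t = x \<bullet> y" unfolding t_def using xy by (intro cos_arccos) auto
  have tpi: "0 \<le> t" "t \<le> pi" unfolding t_def using xy by (auto intro: arccos_lbound arccos_ubound)
  have t0: "t \<noteq> 0" using ct xy by auto
  have ts: "t \<le> 2 * sin t" using tpi ct xy by (intro angle_le_twice_sin) auto
  have spos: "sin t > 0" using ts t0 tpi by linarith
  define e where "e = (y - (x \<bullet> y) *\<^sub>R x) /\<^sub>R sin t"
  have yrep: "y = cos t *\<^sub>R x + sin t *\<^sub>R e" using spos by (simp add: e_def ct)
  have xe: "x \<bullet> e = 0" by (simp add: e_def inner_diff_right xx)
  have ex: "e \<bullet> x = 0" using xe by (simp add: inner_commute)
  have ss: "(norm (y - (x \<bullet> y) *\<^sub>R x))\<^sup>2 = (sin t)\<^sup>2"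
  proof -
    have "(norm (y - (x \<bullet> y) *\<^sub>R x))\<^sup>2 = 1 - (x \<bullet> y)\<^sup>2"
      by (simp only: power2_norm_eq_inner inner_diff_left inner_diff_right)
        (simp add: xx yy inner_commute power2_eq_square)
    then show ?thesis using sin_squared_eq[of t] ct by simp
  qed
  have sn: "norm (y - (x \<bullet> y) *\<^sub>R x) = sin t"
    using power2_eq_imp_eq[OF ss] spos by simp
  then have ne: "norm e = 1" using spos by (simp add: e_def)
  have ee: "e \<bullet> e = 1" using ne by (simp add: norm_eq_1)
  have sr: "sin t \<le> r"
  proof -
    have "(sin t)\<^sup>2 \<le> r\<^sup>2"
    proof -
      have "(sin t)\<^sup>2 = 1 - (x \<bullet> y)\<^sup>2" using sin_squared_eq[of t] ct by simp
      also have "\<dots> \<le> 2 - 2 * (x \<bullet> y)"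
        using zero_le_power2[of "1 - x \<bullet> y"] by (simp add: power2_eq_square algebra_simps)
      finally show ?thesis using \<open>r\<^sup>2 = 2 - 2 * (x \<bullet> y)\<close> by simp
    qed
    then show ?thesis using r by (intro power2_le_imp_le[of "sin t" r]) auto
  qed
  have tr: "t \<le> 2 * r" using ts sr by simp
  define k where "k s = cos s *\<^sub>R x + sin s *\<^sub>R e" for s :: real
  define k' where "k' s = - sin s *\<^sub>R x + cos s *\<^sub>R e" for s :: real
  have "k s \<bullet> k s = (cos s)\<^sup>2 + (sin s)\<^sup>2" for s
    by (simp add: k_def inner_add_left inner_add_right xx ee xe ex power2_eq_square)
  then have kS: "k s \<in> sphere 0 1" for s by (simp add: norm_eq_1)
  have "k' s \<bullet> k' s = (cos s)\<^sup>2 + (sin s)\<^sup>2" for s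
    by (simp add: k'_def inner_add_left inner_add_right inner_diff_left inner_diff_right xx ee xe
          ex power2_eq_square)
  then have k'1: "norm (k' s) = 1" for s by (simp add: norm_eq_1)
  have kd: "(k has_vector_derivative k' s) (at s)" for s
    unfolding k_def k'_def by (auto intro!: derivative_eq_intros simp: algebra_simps)
  have k'd: "(k' has_vector_derivative - k s) (at s)" for s
    unfolding k_def k'_def by (auto intro!: derivative_eq_intros simp: algebra_simps)
  have k0: "k 0 = x" and kt: "k t = y" by (simp_all add: k_def yrep[symmetric])
  \<comment> \<open>Both \<open>k\<close> and \<open>k'\<close> have unit speed, so each of them moves by at most the elapsed time.\<close>
  have kl: "norm (k s - k 0) \<le> s" if "0 \<le> s" for s
  proof -
    have "norm (k s - k 0) \<le> 1 * norm (s - 0)"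
      by (rule differentiable_bound[where S = UNIV and f' = "\<lambda>s h. h *\<^sub>R k' s"])
        (use kd k'1 in \<open>auto simp: has_vector_derivative_def intro!: onorm_le has_derivative_at_withinI\<close>)
    then show ?thesis using that by simp
  qed
  have k'l: "norm (k' s - k' 0) \<le> s" if "0 \<le> s" for s
  proof -
    have "norm (k' s - k' 0) \<le> 1 * norm (s - 0)"
      by (rule differentiable_bound[where S = UNIV and f' = "\<lambda>s h. h *\<^sub>R (- k s)"])
        (use k'd kS in \<open>auto simp: has_vector_derivative_def intro!: onorm_le has_derivative_at_withinI\<close>)
    then show ?thesis using that by simp
  qed
  define f where "f s = g (k s) - (c + q \<bullet> k s)" for s
  define f' where "f' s = k' s \<bullet> (G (k s) - q)" for s
  have fd: "DERIV f s :> f' s" for s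
  proof -
    have "(g has_derivative (\<lambda>h. h \<bullet> G (k s))) (at (k s) within range k)"
      using G[OF kS[of s]] kS unfolding has_tangential_gradient_def
      by (blast intro: has_derivative_subset)
    from has_derivative_in_compose[OF kd[of s, unfolded has_vector_derivative_def] this]
    have 1: "((\<lambda>s. g (k s)) has_derivative (\<lambda>h. (h *\<^sub>R k' s) \<bullet> G (k s))) (at s)" .
    have "((\<lambda>s. c + q \<bullet> k s) has_derivative (\<lambda>h. q \<bullet> (h *\<^sub>R k' s))) (at s)"
      using kd[of s, unfolded has_vector_derivative_def]
      by (auto intro!: derivative_eq_intros)
    from has_derivative_diff[OF 1 this]
    show ?thesis unfolding f_def f'_def has_field_derivative_def
      by (rule has_derivative_eq_rhs) (auto simp: inner_diff_right inner_commute algebra_simps)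
  qed
  have "f 0 = 0" using eq by (simp add: f_def k0)
  have fpos: "0 \<le> f s" for s using le[OF kS[of s]] by (simp add: f_def)
  have f'0: "f' 0 = 0"
    by (rule DERIV_local_min[OF fd zero_less_one]) (use fpos \<open>f 0 = 0\<close> in auto)
  have f'le: "f' s \<le> H * s powr \<alpha> + (N + Q) * s" if s: "0 \<le> s" for s
  proof -
    have "f' s = f' s - f' 0" using f'0 by simp
    also have "\<dots> = k' s \<bullet> (G (k s) - G x) + (k' s - k' 0) \<bullet> (G x - q)"
      by (simp add: f'_def k0 inner_diff_left inner_diff_right)
    also have "\<dots> \<le> 1 * norm (G (k s) - G x) + norm (k' s - k' 0) * norm (G x - q)"
      using norm_cauchy_schwarz[of "k' s" "G (k s) - G x"] k'1[of s]
        norm_cauchy_schwarz[of "k' s - k' 0" "G x - q"] by simp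
    also have "\<dots> \<le> H * s powr \<alpha> + s * (N + Q)"
    proof (rule add_mono)
      have "norm (G (k s) - G x) \<le> H * dist (k s) x powr \<alpha>" by (rule H[OF kS x])
      also have "\<dots> \<le> H * s powr \<alpha>"
        using kl[OF s] H0 \<alpha> by (intro mult_left_mono powr_mono2) (auto simp: k0 dist_norm)
      finally show "1 * norm (G (k s) - G x) \<le> H * s powr \<alpha>" by simp
      have "norm (G x - q) \<le> N + Q" using norm_triangle_ineq4[of "G x" q] N Q by simp
      then show "norm (k' s - k' 0) * norm (G x - q) \<le> s * (N + Q)"
        using k'l[OF s] s by (intro mult_mono) auto
    qed
    finally show ?thesis by (simp add: mult.commute)
  qed
  have NQ: "0 \<le> N + Q" using N Q norm_ge_zero[of "G x"] norm_ge_zero[of q] by linarith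
  have "\<exists>z>0. z < t \<and> f t - f 0 = (t - 0) * f' z"
    using tpi t0 fd by (intro MVT2) auto
  then obtain z where z: "0 < z" "z < t" "f t = t * f' z" using \<open>f 0 = 0\<close> by auto
  have rr: "r \<le> r powr \<alpha>" using r \<alpha> powr_mono'[of \<alpha> 1 r] by simp
  have "z powr \<alpha> \<le> (2 * r) powr \<alpha>" using z tr \<alpha> by (intro powr_mono2) auto
  also have "\<dots> = 2 powr \<alpha> * r powr \<alpha>" using r by (simp add: powr_mult)
  also have "\<dots> \<le> 2 * r powr \<alpha>"
    using \<alpha> powr_mono[of \<alpha> 1 2] by (intro mult_right_mono) auto
  finally have za: "z powr \<alpha> \<le> 2 * r powr \<alpha>" .
  have zb: "z \<le> 2 * r powr \<alpha>" using z tr rr by linarith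
  have "f' z \<le> H * z powr \<alpha> + (N + Q) * z" using f'le z by simp
  also have "\<dots> \<le> H * (2 * r powr \<alpha>) + (N + Q) * (2 * r powr \<alpha>)"
    using za zb H0 NQ by (intro add_mono mult_left_mono) auto
  also have "\<dots> = 2 * (H + N + Q) * r powr \<alpha>" by (simp add: algebra_simps)
  finally have "f' z \<le> 2 * (H + N + Q) * r powr \<alpha>" .
  then have "t * f' z \<le> t * (2 * (H + N + Q) * r powr \<alpha>)" using tpi by (intro mult_left_mono) auto
  also have "\<dots> \<le> (2 * r) * (2 * (H + N + Q) * r powr \<alpha>)"
    using tr H0 NQ by (intro mult_right_mono) (auto intro!: mult_nonneg_nonneg)
  also have "\<dots> = 4 * (H + N + Q) * r powr (1 + \<alpha>)" using r by (simp add: powr_add)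
  finally show ?thesis using z(3) by (simp add: f_def kt r_def)
qed

text \<open>
  At distance more than \<open>1\<close> from \<open>x\<close> the growth bound follows from the size of \<open>g\<close> and
  \<open>L\<close> alone. Treating these \<open>y\<close> separately also avoids antipodal points, which in dimension one
  are not joined to \<open>x\<close> by any great circle.
\<close>

lemma sphere_growth_from_minimum:
  fixes g :: "'a::euclidean_space \<Rightarrow> real" and G :: "'a \<Rightarrow> 'a"
  assumes \<alpha>: "0 < \<alpha>" "\<alpha> \<le> 1"
    and G: "\<And>y. y \<in> sphere 0 1 \<Longrightarrow> has_tangential_gradient g (G y) y"
    and H: "\<And>y z. y \<in> sphere 0 1 \<Longrightarrow> z \<in> sphere 0 1 \<Longrightarrow>
              norm (G y - G z) \<le> H * dist y z powr \<alpha>"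
    and N: "\<And>y. y \<in> sphere 0 1 \<Longrightarrow> norm (G y) \<le> N"
    and M: "\<And>y. y \<in> sphere 0 1 \<Longrightarrow> \<bar>g y\<bar> \<le> M"
    and H0: "0 \<le> H" and q: "norm q \<le> 4 * M"
    and le: "\<And>y. y \<in> sphere 0 1 \<Longrightarrow> c + q \<bullet> y \<le> g y" and eq: "g x = c + q \<bullet> x"
    and x: "x \<in> sphere 0 1" and y: "y \<in> sphere 0 1"
  shows "g y - (c + q \<bullet> y) \<le> 16 * (M + N + H) * dist y x powr (1 + \<alpha>)"
proof -
  have M0: "0 \<le> M" using M[OF x] by linarith
  have N0: "0 \<le> N" using N[OF x] norm_ge_zero[of "G x"] by linarith
  show ?thesis
  proof (cases "dist y x \<le> 1")
    case True
    have "g y - (c + q \<bullet> y) \<le> 4 * (H + N + 4 * M) * dist y x powr (1 + \<alpha>)"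
      by (rule sphere_growth_near_minimum[OF \<alpha> G H N[OF x] q H0 le eq x y True])
    also have "\<dots> \<le> 16 * (M + N + H) * dist y x powr (1 + \<alpha>)"
      using H0 N0 by (intro mult_right_mono) auto
    finally show ?thesis .
  next
    case False
    have "g y - (c + q \<bullet> y) = g y - g x - q \<bullet> (y - x)" using eq by (simp add: inner_diff_right)
    also have "\<dots> \<le> M + M + 4 * M * 2"
    proof -
      have "\<bar>q \<bullet> (y - x)\<bar> \<le> norm q * norm (y - x)" by (rule Cauchy_Schwarz_ineq2)
      also have "\<dots> \<le> 4 * M * 2"
        using q x y norm_triangle_ineq4[of y x] M0 by (intro mult_mono) auto
      finally show ?thesis using M[OF x] M[OF y] by linarith
    qed
    also have "\<dots> \<le> 16 * (M + N + H) * 1" using M0 N0 H0 by simp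
    also have "\<dots> \<le> 16 * (M + N + H) * dist y x powr (1 + \<alpha>)"
      using False M0 N0 H0 \<alpha> by (intro mult_left_mono ge_one_powr_ge_zero) auto
    finally show ?thesis .
  qed
qed

section \<open>Transport of contact points\<close>

text \<open>
  The ray from \<open>w\<close> in direction \<open>y - x\<close> leaves the ball at parameter \<open>t\<close>, while the ray from \<open>x\<close>
  leaves it at parameter \<open>1\<close>. Moving \<open>x\<close> to \<open>w\<close> changes norms by at most \<open>norm (w - x)\<close>, and the
  norm along the second ray grows at rate at least \<open>1/2\<close> near the sphere as \<open>norm x \<le> 1/2\<close>; so
  \<open>t\<close> differs from \<open>1\<close> by at most \<open>2 * norm (w - x)\<close>.
\<close>

lemma sphere_point_parallel_transport:
  fixes x w y :: "'a::euclidean_space"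
  assumes x: "x \<in> ball 0 (1/2)" and w: "w \<in> ball 0 1" and y: "y \<in> sphere 0 1"
  obtains t where "0 < t" "w + t *\<^sub>R (y - x) \<in> sphere 0 1"
    "dist (w + t *\<^sub>R (y - x)) y \<le> 4 * norm (w - x)"
proof -
  have nx: "norm x \<le> 1/2" and nw: "norm w < 1" and ny: "norm y = 1" using x w y by auto
  have d: "1/2 \<le> norm (y - x)" "norm (y - x) \<le> 3/2"
    using norm_triangle_ineq2[of y x] norm_triangle_ineq4[of y x] nx ny by linarith+
  have n4: "norm (w + 4 *\<^sub>R (y - x)) \<ge> 1"
    using norm_triangle_ineq2[of "4 *\<^sub>R (y - x)" "- w"] d nw by (simp add: add.commute)
  have "\<exists>t\<ge>0. t \<le> 4 \<and> norm (w + t *\<^sub>R (y - x)) = 1"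
    using nw n4 by (intro IVT') (auto intro!: continuous_intros)
  then obtain t where t: "0 \<le> t" "norm (w + t *\<^sub>R (y - x)) = 1" by blast
  with nw have tpos: "0 < t" by (cases "t = 0") auto
  define h where "h = w - x"
  have hn: "\<bar>norm (x + t *\<^sub>R (y - x)) - 1\<bar> \<le> norm h"
    using norm_triangle_ineq3[of "x + t *\<^sub>R (y - x)" "w + t *\<^sub>R (y - x)"] t
    by (simp add: h_def norm_minus_commute)
  have rep: "x + t *\<^sub>R (y - x) = t *\<^sub>R y + (1 - t) *\<^sub>R x" by (simp add: algebra_simps)
  have b: "norm ((1 - t) *\<^sub>R x) \<le> \<bar>1 - t\<bar> / 2"
    using mult_left_mono[OF nx, of "\<bar>1 - t\<bar>"] by simp
  have "\<bar>t - 1\<bar> \<le> 2 * norm h"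
  proof (cases "t \<le> 1")
    case True
    have "norm (t *\<^sub>R y) = t" using t True ny by simp
    then have "norm (x + t *\<^sub>R (y - x)) \<le> t + (1 - t) / 2"
      unfolding rep using norm_triangle_ineq[of "t *\<^sub>R y" "(1 - t) *\<^sub>R x"] b True by linarith
    with hn True show ?thesis by (simp add: abs_le_iff field_simps)
  next
    case False
    have "norm (t *\<^sub>R y) = t" using t False ny by simp
    then have "norm (x + t *\<^sub>R (y - x)) \<ge> t - (t - 1) / 2"
      unfolding rep using norm_diff_ineq[of "t *\<^sub>R y" "(1 - t) *\<^sub>R x"] b False
      by (simp add: abs_if field_simps split: if_splits)
    with hn False show ?thesis by (simp add: abs_le_iff field_simps)
  qed
  then have tb: "\<bar>t - 1\<bar> * norm (y - x) \<le> 2 * norm h * (3/2)" using d by (intro mult_mono) auto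
  have "w + t *\<^sub>R (y - x) - y = h + (t - 1) *\<^sub>R (y - x)" by (simp add: h_def algebra_simps)
  then have "dist (w + t *\<^sub>R (y - x)) y \<le> norm h + \<bar>t - 1\<bar> * norm (y - x)"
    using norm_triangle_ineq[of h "(t - 1) *\<^sub>R (y - x)"] by (simp add: dist_norm)
  with tb have "dist (w + t *\<^sub>R (y - x)) y \<le> 4 * norm h" by simp
  with tpos t show thesis by (intro that[of t]) (auto simp: h_def)
qed

text \<open>
  The slope \<open>s\<close> of the affine function supporting the envelope at \<open>w\<close> stands in for explicit
  convex weights: as \<open>x\<close> is in the hull of the contact points, some contact point \<open>y\<close> has
  \<open>(s - q) \<bullet> (y - x) \<ge> 0\<close>, and comparing the two affine functions at the transported point
  suffices.
\<close>

lemma convex_envelope_transport: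
  fixes g :: "'a::euclidean_space \<Rightarrow> real"
  assumes g: "continuous_on (sphere 0 1) g" and w: "w \<in> ball 0 1"
    and hull: "x \<in> convex hull Z"
    and Z: "\<And>y. y \<in> Z \<Longrightarrow> \<exists>t>0. w + t *\<^sub>R (y - x) \<in> sphere 0 1 \<and>
              g (w + t *\<^sub>R (y - x)) \<le> c + q \<bullet> (w + t *\<^sub>R (y - x)) + \<epsilon>"
  shows "convex_envelope g w \<le> c + q \<bullet> w + \<epsilon>"
proof -
  obtain s where s: "\<And>y. y \<in> sphere 0 1 \<Longrightarrow> convex_envelope g w + s \<bullet> (y - w) \<le> g y"
    using convex_envelope_support[OF g w] by blast
  obtain y where y: "y \<in> Z" "0 \<le> (s - q) \<bullet> (y - x)"
    using convex_hull_meets_halfspace[OF hull] by blast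
  obtain t where t: "t > 0" "w + t *\<^sub>R (y - x) \<in> sphere 0 1"
      "g (w + t *\<^sub>R (y - x)) \<le> c + q \<bullet> (w + t *\<^sub>R (y - x)) + \<epsilon>"
    using Z[OF y(1)] by blast
  have "convex_envelope g w + t * (s \<bullet> (y - x)) \<le> c + q \<bullet> w + t * (q \<bullet> (y - x)) + \<epsilon>"
    using s[OF t(2)] t(3) by (simp add: inner_add_right)
  moreover have "0 \<le> t * ((s - q) \<bullet> (y - x))" using t(1) y(2) by simp
  ultimately show ?thesis by (simp add: inner_diff_left algebra_simps)
qed

section \<open>Regularity of the convex envelope\<close>

lemma convex_envelope_upper_growth:
  fixes g :: "'a::euclidean_space \<Rightarrow> real" and G :: "'a \<Rightarrow> 'a"
  assumes \<alpha>: "0 < \<alpha>" "\<alpha> \<le> 1"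
    and G: "\<And>y. y \<in> sphere 0 1 \<Longrightarrow> has_tangential_gradient g (G y) y"
    and H: "\<And>y z. y \<in> sphere 0 1 \<Longrightarrow> z \<in> sphere 0 1 \<Longrightarrow>
              norm (G y - G z) \<le> H * dist y z powr \<alpha>"
    and N: "\<And>y. y \<in> sphere 0 1 \<Longrightarrow> norm (G y) \<le> N"
    and M: "\<And>y. y \<in> sphere 0 1 \<Longrightarrow> \<bar>g y\<bar> \<le> M"
    and H0: "0 \<le> H"
    and x: "x \<in> ball 0 (1/2)"
  obtains q where "norm q \<le> 4 * M"
    "\<And>w. w \<in> ball 0 1 \<Longrightarrow> convex_envelope g x + q \<bullet> (w - x) \<le> convex_envelope g w"
    "\<And>w. w \<in> ball 0 1 \<Longrightarrow> convex_envelope g w \<le>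
       convex_envelope g x + q \<bullet> (w - x) + 256 * (M + N + H) * norm (w - x) powr (1 + \<alpha>)"
proof -
  have g: "continuous_on (sphere 0 1) g"
    unfolding continuous_on_eq_continuous_within
    using G has_derivative_continuous unfolding has_tangential_gradient_def by blast
  have x1: "x \<in> ball 0 1" using x by auto
  obtain q where le: "\<And>y. y \<in> sphere 0 1 \<Longrightarrow> convex_envelope g x + q \<bullet> (y - x) \<le> g y"
    and hull: "x \<in> convex hull {y \<in> sphere 0 1. g y = convex_envelope g x + q \<bullet> (y - x)}"
    using convex_envelope_support[OF g x1] by blast
  define c where "c = convex_envelope g x - q \<bullet> x"
  have cq: "convex_envelope g x + q \<bullet> (z - x) = c + q \<bullet> z" for z
    by (simp add: c_def inner_diff_right)
  have qM: "norm q \<le> 4 * M"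
  proof (rule supporting_slope_bound[OF _ _ x le])
    show "g y \<le> M" if "y \<in> sphere 0 1" for y using M[OF that] by simp
    show "- M \<le> convex_envelope g x" using convex_envelope_bounds[OF g M x1] by simp
  qed
  obtain y0 :: 'a where y0: "y0 \<in> sphere 0 1" using vector_choose_size[of 1] by auto
  have K0: "0 \<le> M + N + H"
    using M[OF y0] N[OF y0] H0 norm_ge_zero[of "G y0"] by linarith
  show thesis
  proof (rule that[OF qM])
    fix w :: 'a assume w: "w \<in> ball 0 1"
    show "convex_envelope g x + q \<bullet> (w - x) \<le> convex_envelope g w"
      unfolding cq using w le cq by (intro affine_le_convex_envelope) auto
    have "convex_envelope g w \<le> c + q \<bullet> w + 256 * (M + N + H) * norm (w - x) powr (1 + \<alpha>)"
    proof (rule convex_envelope_transport[OF g w hull])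
      fix y assume "y \<in> {y \<in> sphere 0 1. g y = convex_envelope g x + q \<bullet> (y - x)}"
      then have y: "y \<in> sphere 0 1" "g y = c + q \<bullet> y" by (auto simp: cq)
      obtain t where t: "0 < t" "w + t *\<^sub>R (y - x) \<in> sphere 0 1"
          "dist (w + t *\<^sub>R (y - x)) y \<le> 4 * norm (w - x)"
        using sphere_point_parallel_transport[OF x w y(1)] by blast
      define y' where "y' = w + t *\<^sub>R (y - x)"
      have le': "c + q \<bullet> z \<le> g z" if "z \<in> sphere 0 1" for z
        using le[OF that] cq[of z] by simp
      have "g y' - (c + q \<bullet> y') \<le> 16 * (M + N + H) * dist y' y powr (1 + \<alpha>)"
        using t(2) unfolding y'_def[symmetric]
        by (intro sphere_growth_from_minimum[OF \<alpha> G H N M H0 qM le' y(2) y(1)]) auto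
      also have "\<dots> \<le> 16 * (M + N + H) * (4 * norm (w - x)) powr (1 + \<alpha>)"
        using t(3) K0 \<alpha> unfolding y'_def[symmetric] by (intro mult_left_mono powr_mono2) auto
      also have "\<dots> = 16 * (M + N + H) * (4 powr (1 + \<alpha>) * norm (w - x) powr (1 + \<alpha>))"
        by (simp add: powr_mult)
      also have "\<dots> \<le> 16 * (M + N + H) * (16 * norm (w - x) powr (1 + \<alpha>))"
        using K0 \<alpha> powr_mono[of "1 + \<alpha>" 2 4]
        by (intro mult_left_mono mult_right_mono) auto
      finally show "\<exists>t>0. w + t *\<^sub>R (y - x) \<in> sphere 0 1 \<and>
          g (w + t *\<^sub>R (y - x)) \<le> c + q \<bullet> (w + t *\<^sub>R (y - x))
            + 256 * (M + N + H) * norm (w - x) powr (1 + \<alpha>)"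
        using t unfolding y'_def by (intro exI[of _ t]) (auto simp: algebra_simps)
    qed
    then show "convex_envelope g w \<le>
        convex_envelope g x + q \<bullet> (w - x) + 256 * (M + N + H) * norm (w - x) powr (1 + \<alpha>)"
      by (simp only: cq)
  qed
qed

lemma gderiv_of_powr_bound:
  fixes f :: "'a::euclidean_space \<Rightarrow> real"
  assumes \<alpha>: "0 < \<alpha>" and S: "open S" "x \<in> S"
    and b: "\<And>w. w \<in> S \<Longrightarrow> \<bar>f w - f x - q \<bullet> (w - x)\<bar> \<le> K * norm (w - x) powr (1 + \<alpha>)"
  shows "GDERIV f x :> q"
proof -
  have "((\<lambda>w. (f w - f x - (w - x) \<bullet> q) / norm (w - x)) \<longlongrightarrow> 0) (at x)"
  proof (rule Lim_null_comparison)
    show "\<forall>\<^sub>F w in at x. norm ((f w - f x - (w - x) \<bullet> q) / norm (w - x))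
            \<le> K * norm (w - x) powr \<alpha>"
    proof -
      have "\<forall>\<^sub>F w in at x. w \<in> S \<and> w \<noteq> x"
        using S by (auto simp: eventually_at_topological)
      then show ?thesis
      proof eventually_elim
        case (elim w)
        then have "norm (w - x) > 0" by simp
        with b[of w] elim show ?case
          by (simp add: inner_commute powr_add divide_le_eq mult.assoc mult.commute mult.left_commute)
      qed
    qed
    have "((\<lambda>w. K * norm (w - x) powr \<alpha>) \<longlongrightarrow> K * norm (x - x) powr \<alpha>) (at x)"
      using \<alpha> by (intro tendsto_intros) (auto intro: always_eventually)
    then show "((\<lambda>w. K * norm (w - x) powr \<alpha>) \<longlongrightarrow> 0) (at x)" using \<alpha> by simp
  qed
  then show ?thesis
    unfolding gderiv_def has_derivative_at_within
    by (auto simp: bounded_linear_inner_left divide_inverse mult.commute)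
qed

text \<open>
  Evaluate the supporting function at \<open>y\<close> and the upper bound centred at \<open>x\<close> at
  \<open>w = y + (r/4) *\<^sub>R e\<close>, where \<open>r = dist x y\<close> and \<open>e\<close> points in the direction of \<open>qy - qx\<close>; the
  factor \<open>1/4\<close> keeps \<open>w\<close> in the unit ball.
\<close>

lemma subgradient_holder:
  fixes f :: "'a::euclidean_space \<Rightarrow> real"
  assumes \<alpha>: "0 < \<alpha>" "\<alpha> \<le> 1" and K: "0 \<le> K"
    and x: "x \<in> ball 0 (1/2)" and y: "y \<in> ball 0 (1/2)" and ne: "x \<noteq> y"
    and up: "\<And>w. w \<in> ball 0 1 \<Longrightarrow> f w \<le> f x + qx \<bullet> (w - x) + K * norm (w - x) powr (1 + \<alpha>)"
    and lowx: "\<And>w. w \<in> ball 0 1 \<Longrightarrow> f x + qx \<bullet> (w - x) \<le> f w"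
    and lowy: "\<And>w. w \<in> ball 0 1 \<Longrightarrow> f y + qy \<bullet> (w - y) \<le> f w"
  shows "norm (qx - qy) \<le> 16 * K * dist x y powr \<alpha>"
proof (cases "qx = qy")
  case True
  with K show ?thesis by simp
next
  case False
  define r where "r = dist x y"
  have r: "0 < r" using ne by (simp add: r_def)
  have r1: "r < 1"
    using norm_triangle_ineq4[of x y] x y by (simp add: r_def dist_norm)
  define e where "e = (qy - qx) /\<^sub>R norm (qy - qx)"
  have en: "norm e = 1" using False by (simp add: e_def)
  have qe: "(qy - qx) \<bullet> e = norm (qx - qy)"
    using False by (simp add: e_def dot_square_norm power2_eq_square norm_minus_commute)
  define w where "w = y + (r/4) *\<^sub>R e"
  have w: "w \<in> ball 0 1"
    using norm_triangle_ineq[of y "(r/4) *\<^sub>R e"] y r r1 en by (simp add: w_def)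
  have wx: "norm (w - x) \<le> 2 * r"
  proof -
    have "w - x = (y - x) + (r/4) *\<^sub>R e" by (simp add: w_def)
    then have "norm (w - x) \<le> norm (y - x) + norm ((r/4) *\<^sub>R e)"
      using norm_triangle_ineq by metis
    also have "\<dots> = r + r/4" using r en by (simp add: r_def dist_norm norm_minus_commute)
    finally show ?thesis using r by simp
  qed
  have y1: "y \<in> ball 0 1" using y by auto
  have "f y + qy \<bullet> (w - y) \<le> f x + qx \<bullet> (w - x) + K * norm (w - x) powr (1 + \<alpha>)"
    using up[OF w] lowy[OF w] by simp
  with lowx[OF y1] have "(qy - qx) \<bullet> (w - y) \<le> K * norm (w - x) powr (1 + \<alpha>)"
    by (simp add: inner_diff_left inner_diff_right)
  also have "(qy - qx) \<bullet> (w - y) = r / 4 * norm (qx - qy)" by (simp add: w_def qe)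
  also have "K * norm (w - x) powr (1 + \<alpha>) \<le> K * (2 * r) powr (1 + \<alpha>)"
    using wx K \<alpha> by (intro mult_left_mono powr_mono2) auto
  also have "(2 * r) powr (1 + \<alpha>) = 2 powr (1 + \<alpha>) * (r * r powr \<alpha>)"
    using r by (simp add: powr_mult powr_add)
  also have "K * (2 powr (1 + \<alpha>) * (r * r powr \<alpha>)) \<le> K * (4 * (r * r powr \<alpha>))"
    using K r \<alpha> powr_mono[of "1 + \<alpha>" 2 2] by (intro mult_left_mono mult_right_mono) auto
  finally have "r * norm (qx - qy) \<le> r * (16 * K * r powr \<alpha>)" by (simp add: algebra_simps)
  then show ?thesis using r by (simp add: r_def)
qed

lemma C1_holder_on_boundI:
  fixes f :: "'a::euclidean_space \<Rightarrow> real"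
  assumes D: "\<And>x. x \<in> ball 0 (1/2) \<Longrightarrow> GDERIV f x :> q x"
    and A: "\<And>x. x \<in> ball 0 (1/2) \<Longrightarrow> \<bar>f x\<bar> \<le> A"
    and B: "\<And>x. x \<in> ball 0 (1/2) \<Longrightarrow> norm (q x) \<le> B"
    and C: "\<And>x y. x \<in> ball 0 (1/2) \<Longrightarrow> y \<in> ball 0 (1/2) \<Longrightarrow> x \<noteq> y \<Longrightarrow>
              norm (q x - q y) \<le> C * dist x y powr \<alpha>"
  shows "C1_holder_on \<alpha> (ball 0 (1/2)) f \<and>
    C1_holder_norm \<alpha> (ball 0 (1/2)) f (gradient f) \<le> A + B + C"
proof -
  let ?X = "ball (0::'a) (1/2)"
  have gr: "gradient f x = q x" if "x \<in> ?X" for x using D[OF that] by (rule gradient_eq)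
  have quot: "d \<le> C" if dq: "d \<in> holder_quotients \<alpha> ?X (gradient f)" for d
  proof -
    obtain x y where d: "x \<in> ?X" "y \<in> ?X" "x \<noteq> y"
        "d = norm (gradient f x - gradient f y) / dist x y powr \<alpha>"
      using dq unfolding holder_quotients_def by blast
    have "dist x y powr \<alpha> > 0" using d(3) by simp
    with C[OF d(1-3)] show ?thesis
      unfolding d(4) gr[OF d(1)] gr[OF d(2)] by (simp add: divide_le_eq)
  qed
  have B': "norm (gradient f x) \<le> B" if "x \<in> ?X" for x using B[OF that] gr[OF that] by simp
  obtain v :: 'a where v: "norm v = 1/4" using vector_choose_size[of "1/4"] by auto
  have X0: "(0::'a) \<in> ?X" "v \<in> ?X" "0 \<noteq> v" using v by auto
  have ne: "holder_quotients \<alpha> ?X (gradient f) \<noteq> {}"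
    unfolding holder_quotients_def using X0 by blast
  have "C1_holder_bounded \<alpha> ?X f (gradient f)"
    unfolding C1_holder_bounded_def
  proof (intro conjI)
    show "bdd_above ((\<lambda>x. \<bar>f x\<bar>) ` ?X)" using A by (intro bdd_aboveI2)
    show "bdd_above ((\<lambda>x. norm (gradient f x)) ` ?X)" using B' by (intro bdd_aboveI2)
    show "bdd_above (holder_quotients \<alpha> ?X (gradient f))" using quot by (intro bdd_aboveI)
  qed
  moreover have "C1_holder_norm \<alpha> ?X f (gradient f) \<le> A + B + C"
    unfolding C1_holder_norm_def
  proof (intro add_mono)
    show "(SUP x\<in>?X. \<bar>f x\<bar>) \<le> A" using X0 A by (intro cSUP_least) auto
    show "(SUP x\<in>?X. norm (gradient f x)) \<le> B" using X0 B' by (intro cSUP_least) auto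
    show "Sup (holder_quotients \<alpha> ?X (gradient f)) \<le> C" using ne quot by (intro cSup_least)
  qed
  ultimately show ?thesis using D unfolding C1_holder_on_def by blast
qed

lemma convex_envelope_C1_holder:
  fixes g :: "'a::euclidean_space \<Rightarrow> real"
  assumes \<alpha>: "0 < \<alpha>" "\<alpha> \<le> 1" and gs: "C1_holder_sphere \<alpha> g"
  shows "C1_holder_on \<alpha> (ball 0 (1/2)) (convex_envelope g) \<and>
    C1_holder_norm \<alpha> (ball 0 (1/2)) (convex_envelope g) (gradient (convex_envelope g))
      \<le> 5000 * C1_holder_norm \<alpha> (sphere 0 1) g (tangential_gradient g)"
proof -
  let ?S = "sphere (0::'a) 1" and ?u = "convex_envelope g"
  define G where "G = tangential_gradient g"
  define M where "M = (SUP x\<in>?S. \<bar>g x\<bar>)"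
  define N where "N = (SUP x\<in>?S. norm (G x))"
  define H where "H = Sup (holder_quotients \<alpha> ?S G)"
  have bdd: "bdd_above ((\<lambda>x. \<bar>g x\<bar>) ` ?S)" "bdd_above ((\<lambda>x. norm (G x)) ` ?S)"
      "bdd_above (holder_quotients \<alpha> ?S G)"
    using gs unfolding C1_holder_sphere_def C1_holder_bounded_def G_def by auto
  have G: "has_tangential_gradient g (G y) y" if y: "y \<in> ?S" for y
  proof -
    obtain p where p: "has_tangential_gradient g p y"
      using gs y unfolding C1_holder_sphere_def by blast
    with tangential_gradient_eq[OF y p] show ?thesis by (simp add: G_def)
  qed
  have M: "\<bar>g y\<bar> \<le> M" if "y \<in> ?S" for y
    unfolding M_def by (rule cSUP_upper[OF that bdd(1)])
  have N: "norm (G y) \<le> N" if "y \<in> ?S" for y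
    unfolding N_def by (rule cSUP_upper[OF that bdd(2)])
  have quot: "norm (G y - G z) / dist y z powr \<alpha> \<le> H" if "y \<in> ?S" "z \<in> ?S" "y \<noteq> z" for y z
    unfolding H_def
    by (rule cSup_upper[OF _ bdd(3)]) (use that in \<open>auto simp: holder_quotients_def\<close>)
  have H: "norm (G y - G z) \<le> H * dist y z powr \<alpha>" if "y \<in> ?S" "z \<in> ?S" for y z
  proof (cases "y = z")
    case False
    then have "dist y z powr \<alpha> > 0" by simp
    with quot[OF that False] show ?thesis by (simp add: divide_le_eq)
  qed simp
  obtain y0 :: 'a where y0: "norm y0 = 1" using vector_choose_size[of 1] by auto
  have S0: "y0 \<in> ?S" "- y0 \<in> ?S" "y0 \<noteq> - y0" using y0 neg_equal_zero norm_zero zero_neq_one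
    by (auto simp: eq_neg_iff_add_eq_0 scaleR_2[symmetric])
  have H0: "0 \<le> H" using quot[OF S0] by (rule order_trans[rotated]) simp
  have M0: "0 \<le> M" using M[OF S0(1)] by linarith
  have N0: "0 \<le> N" using N[OF S0(1)] norm_ge_zero[of "G y0"] by linarith
  define K where "K = 256 * (M + N + H)"
  have K0: "0 \<le> K" using M0 N0 H0 by (simp add: K_def)
  have "\<forall>x\<in>ball 0 (1/2). \<exists>q. norm q \<le> 4 * M \<and>
      (\<forall>w\<in>ball 0 1. ?u x + q \<bullet> (w - x) \<le> ?u w) \<and>
      (\<forall>w\<in>ball 0 1. ?u w \<le> ?u x + q \<bullet> (w - x) + K * norm (w - x) powr (1 + \<alpha>))"
    using convex_envelope_upper_growth[OF \<alpha> G H N M H0] unfolding K_def by metis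
  then obtain q where q: "\<And>x. x \<in> ball 0 (1/2) \<Longrightarrow> norm (q x) \<le> 4 * M"
    "\<And>x w. x \<in> ball 0 (1/2) \<Longrightarrow> w \<in> ball 0 1 \<Longrightarrow> ?u x + q x \<bullet> (w - x) \<le> ?u w"
    "\<And>x w. x \<in> ball 0 (1/2) \<Longrightarrow> w \<in> ball 0 1 \<Longrightarrow>
       ?u w \<le> ?u x + q x \<bullet> (w - x) + K * norm (w - x) powr (1 + \<alpha>)"
    by metis
  have g: "continuous_on ?S g"
    unfolding continuous_on_eq_continuous_within
    using G has_derivative_continuous unfolding has_tangential_gradient_def by blast
  have main: "C1_holder_on \<alpha> (ball 0 (1/2)) ?u \<and>
      C1_holder_norm \<alpha> (ball 0 (1/2)) ?u (gradient ?u) \<le> M + 4 * M + 16 * K"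
  proof (rule C1_holder_on_boundI)
    fix x :: 'a assume x: "x \<in> ball 0 (1/2)"
    then have x1: "x \<in> ball 0 1" by auto
    have "\<bar>?u w - ?u x - q x \<bullet> (w - x)\<bar> \<le> K * norm (w - x) powr (1 + \<alpha>)"
      if "w \<in> ball 0 1" for w
      using q(2,3)[OF x that] by (simp add: abs_le_iff)
    then show "GDERIV ?u x :> q x"
      by (rule gderiv_of_powr_bound[OF \<alpha>(1) open_ball x1])
    show "\<bar>?u x\<bar> \<le> M" by (rule convex_envelope_bounds[OF g M x1])
    show "norm (q x) \<le> 4 * M" by (rule q(1)[OF x])
    fix y :: 'a assume "y \<in> ball 0 (1/2)" "x \<noteq> y"
    then show "norm (q x - q y) \<le> 16 * K * dist x y powr \<alpha>"
      using x by (intro subgradient_holder[OF \<alpha> K0, where f = ?u] q(2,3)) auto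
  qed
  have "M + 4 * M + 16 * K \<le> 5000 * (M + N + H)" using M0 N0 H0 by (simp add: K_def)
  also have "M + N + H = C1_holder_norm \<alpha> ?S g (tangential_gradient g)"
    by (simp add: C1_holder_norm_def M_def N_def H_def G_def)
  finally show ?thesis using main by auto
qed

theorem theorem5p1:
  fixes \<alpha> :: real
  assumes "0 < \<alpha>" and "\<alpha> \<le> 1"
  shows "\<exists>C. \<forall>g :: real ^ 'n \<Rightarrow> real. C1_holder_sphere \<alpha> g \<longrightarrow>
           C1_holder_on \<alpha> (ball 0 (1/2)) (convex_envelope g) \<and>
           C1_holder_norm \<alpha> (ball 0 (1/2)) (convex_envelope g) (gradient (convex_envelope g))
             \<le> C * C1_holder_norm \<alpha> (sphere 0 1) g (tangential_gradient g)"
  using convex_envelope_C1_holder[OF assms] by blast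

end
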